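(* Let $(G,\sigma)$ and $(H,\pi)$ be signed graphs. There is a homomorphism of the signed graph $(G,\sigma)$ to the signed graph $(H,\pi)$ if and only if there is a color-preserving homomorphism of $\mathrm{EDC}(G,\sigma)$ to $\mathrm{EDC}(H,\pi)$.
   Context: Graphs may have loops and multiple edges; each edge has a multiset of two endpoints. A graph homomorphism maps vertices to vertices and edges to edges and preserves incidence. A signed graph $(G,\sigma)$ is a graph with a map $\sigma:E(G)\to\{+,-\}$. The sign of a walk is the product of the signs of its edges, counted with repetition. A homomorphism of signed graphs $(G,\sigma)\to(H,\pi)$ is a graph homomorphism of $G$ to $H$ that preserves the signs of closed walks. Viewing a signed graph as a 2-edge-colored graph with colors $+$ and $-$, a color-preserving homomorphism is a graph homomorphism in which each edge has the same color (sign) as its image. The extended double cover $\mathrm{EDC}(G,\sigma)$ is the signed graph on vertex set $V^+\cup V^-$, where $V^{\pm}=\{v^{\pm}:v\in V(G)\}$ are two disjoint copies of $V(G)$, with the following edges: for each vertex $x$ of $G$, a negative edge joining $x^+$ and $x^-$; for each positive edge $uv$ of $(G,\sigma)$, two positive edges $u^+v^+$ and $u^-v^-$; for each negative edge $uv$ of $(G,\sigma)$, two positive edges $u^+v^-$ and $u^-v^+$. *)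

theory Defs
  imports Main "HOL-Library.Multiset" "HOL-Library.FuncSet"
begin

datatype sign = Pos | Neg

instantiation sign :: comm_monoid_mult
begin

definition one_sign :: sign where
  "1 = Pos"

definition times_sign :: "sign \<Rightarrow> sign \<Rightarrow> sign" where
  "a * b = (if a = b then Pos else Neg)"

instance
proof
  fix a b c :: sign
  show "a * b * c = a * (b * c)"
    by (cases a; cases b; cases c) (simp_all add: times_sign_def)
  show "a * b = b * a"
    by (simp add: times_sign_def)
  show "1 * a = a"
    by (cases a) (simp_all add: times_sign_def one_sign_def)
qed

end

record ('v, 'e) graph =
  verts :: "'v set"
  edges :: "'e set"
  ends :: "'e \<Rightarrow> 'v multiset"

record ('v, 'e) sgraph = "('v, 'e) graph" +
  esign :: "'e \<Rightarrow> sign"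

text \<open>
  Vertex and edge sets may be empty or infinite. The functions \<open>ends\<close> and \<open>esign\<close> are only
  meaningful on the edge set. Since every value of \<open>esign\<close> is a sign, \<open>wf_graph\<close> is also the
  well-formedness condition for signed graphs.
\<close>

definition wf_graph :: "('v, 'e, 'a) graph_scheme \<Rightarrow> bool" where
  "wf_graph G \<longleftrightarrow> (\<forall>e\<in>edges G. size (ends G e) = 2 \<and> set_mset (ends G e) \<subseteq> verts G)"

definition graph_hom ::
  "('v, 'e, 'a) graph_scheme \<Rightarrow> ('w, 'd, 'b) graph_scheme \<Rightarrow> ('v \<Rightarrow> 'w) \<Rightarrow> ('e \<Rightarrow> 'd) \<Rightarrow> bool" where
  "graph_hom G H f g \<longleftrightarrow>
     f \<in> verts G \<rightarrow> verts H \<and> g \<in> edges G \<rightarrow> edges H \<and>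
     (\<forall>e\<in>edges G. ends H (g e) = image_mset f (ends G e))"

text \<open>
  The walk \<open>v\<^sub>0, e\<^sub>1, v\<^sub>1, \<dots>, e\<^sub>n, v\<^sub>n\<close> is given by its initial vertex \<open>v\<^sub>0\<close>, the list
  \<open>[(e\<^sub>1, v\<^sub>1), \<dots>, (e\<^sub>n, v\<^sub>n)]\<close> and its final vertex \<open>v\<^sub>n\<close>. It is closed if \<open>v\<^sub>0 = v\<^sub>n\<close>.
\<close>

fun walk :: "('v, 'e, 'a) graph_scheme \<Rightarrow> 'v \<Rightarrow> ('e \<times> 'v) list \<Rightarrow> 'v \<Rightarrow> bool" where
  "walk G u [] w \<longleftrightarrow> u \<in> verts G \<and> u = w"
| "walk G u ((e, v) # p) w \<longleftrightarrow>
     u \<in> verts G \<and> e \<in> edges G \<and> ends G e = {#u, v#} \<and> walk G v p w"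

definition walk_sign :: "('v, 'e) sgraph \<Rightarrow> ('e \<times> 'v) list \<Rightarrow> sign" where
  "walk_sign G p = prod_list (map (\<lambda>(e, v). esign G e) p)"

definition signed_hom ::
  "('v, 'e) sgraph \<Rightarrow> ('w, 'd) sgraph \<Rightarrow> ('v \<Rightarrow> 'w) \<Rightarrow> ('e \<Rightarrow> 'd) \<Rightarrow> bool" where
  "signed_hom G H f g \<longleftrightarrow>
     graph_hom G H f g \<and>
     (\<forall>v p. walk G v p v \<longrightarrow> walk_sign H (map (map_prod g f) p) = walk_sign G p)"

definition color_hom ::
  "('v, 'e) sgraph \<Rightarrow> ('w, 'd) sgraph \<Rightarrow> ('v \<Rightarrow> 'w) \<Rightarrow> ('e \<Rightarrow> 'd) \<Rightarrow> bool" where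
  "color_hom G H f g \<longleftrightarrow>
     graph_hom G H f g \<and> (\<forall>e\<in>edges G. esign H (g e) = esign G e)"

definition end_pair :: "('v, 'e, 'a) graph_scheme \<Rightarrow> 'e \<Rightarrow> 'v \<times> 'v" where
  "end_pair G e = (SOME (u, v). ends G e = {#u, v#})"

text \<open>
  In the extended double cover, \<open>(v, Pos)\<close> and \<open>(v, Neg)\<close> are the vertices \<open>v\<^sup>+\<close> and \<open>v\<^sup>-\<close>.
  \<open>Fiber x\<close> is the negative edge joining \<open>x\<^sup>+\<close> and \<open>x\<^sup>-\<close>, and \<open>Lift e Pos\<close>, \<open>Lift e Neg\<close> are
  the two positive edges arising from \<open>e\<close>. If \<open>e\<close> is negative, telling these two apart needs an
  ordering of its endpoints; \<open>end_pair\<close> fixes one, and the other one would merely exchange the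
  two names. A negative loop at \<open>v\<close> gives two parallel edges joining \<open>v\<^sup>+\<close> and \<open>v\<^sup>-\<close>.
\<close>

datatype ('v, 'e) edc_edge = Fiber 'v | Lift 'e sign

definition lift_ends :: "('v, 'e) sgraph \<Rightarrow> 'e \<Rightarrow> sign \<Rightarrow> ('v \<times> sign) multiset" where
  "lift_ends G e s =
     (case end_pair G e of (u, v) \<Rightarrow>
        (case esign G e of
           Pos \<Rightarrow> {#(u, s), (v, s)#}
         | Neg \<Rightarrow> {#(u, s), (v, Neg * s)#}))"

definition EDC :: "('v, 'e) sgraph \<Rightarrow> ('v \<times> sign, ('v, 'e) edc_edge) sgraph" where
  "EDC G =
     \<lparr> verts = verts G \<times> UNIV,
       edges = {Fiber x | x. x \<in> verts G} \<union> {Lift e s | e s. e \<in> edges G},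
       ends = (\<lambda>a. case a of Fiber x \<Rightarrow> {#(x, Pos), (x, Neg)#} | Lift e s \<Rightarrow> lift_ends G e s),
       esign = (\<lambda>a. case a of Fiber x \<Rightarrow> Neg | Lift e s \<Rightarrow> Pos) \<rparr>"

lemma end_pair:
  assumes "wf_graph G" "e \<in> edges G" "end_pair G e = (u, v)"
  shows "ends G e = {#u, v#}"
proof -
  have size: "size (ends G e) = Suc 1"
    using assms by (simp add: wf_graph_def)
  then obtain a N where N: "ends G e = add_mset a N"
    using size_eq_Suc_imp_eq_union by blast
  with size have "size N = 1"
    by simp
  then obtain b where "N = {#b#}"
    using size_1_singleton_mset by blast
  with N have "case (a, b) of (u, v) \<Rightarrow> ends G e = {#u, v#}"
    by simp
  then have "case end_pair G e of (u, v) \<Rightarrow> ends G e = {#u, v#}"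
    unfolding end_pair_def by (rule someI)
  with assms show ?thesis
    by simp
qed

lemma wf_graph_EDC:
  assumes "wf_graph G"
  shows "wf_graph (EDC G)"
proof -
  have "size (lift_ends G e s) = 2 \<and> set_mset (lift_ends G e s) \<subseteq> verts G \<times> UNIV"
    if e: "e \<in> edges G" for e s
  proof -
    obtain u v where uv: "end_pair G e = (u, v)"
      by fastforce
    then have "ends G e = {#u, v#}"
      by (rule end_pair[OF assms e])
    then have "u \<in> verts G" "v \<in> verts G"
      using assms e by (auto simp: wf_graph_def)
    with uv show ?thesis
      by (auto simp: lift_ends_def split: sign.splits)
  qed
  then show ?thesis
    by (fastforce simp: wf_graph_def EDC_def)
qed

end

theory Submission
  imports Defs
begin

text \<open>
  Both sides of the equivalence say that \<open>\<sigma>\<close> and the pulled-back signature \<open>\<pi> \<circ> g\<close> are switching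
  equivalent: there is a function \<open>c\<close> from vertices to signs with
  \<open>\<pi> (g e) = c u * c v * \<sigma> e\<close> for every edge \<open>e = uv\<close>.

  For signed homomorphisms (\<open>signed_hom_iff_switching\<close>) this is the classical fact that a signature
  in which all closed walks are positive comes from a potential \<open>c\<close>, here applied to the quotient
  of the two signatures. The potential at \<open>v\<close> is the sign of any walk from a fixed root of the
  component of \<open>v\<close>; it satisfies the equation at \<open>uv\<close> because the walk root--\<open>u\<close>--\<open>v\<close>--root is
  closed.

  For color-preserving homomorphisms of the double covers, the negative edges are exactly the
  fibers, so fibers go to fibers. Hence a homomorphism acts as \<open>v\<^sup>s \<mapsto> (f v)\<^bsup>c v * s\<^esup>\<close>, where
  \<open>c v\<close> records whether the fiber of \<open>v\<close> gets flipped. A positive edge between \<open>u\<^sup>a\<close> and \<open>v\<^sup>b\<close>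
  lies over an edge \<open>uv\<close> of sign \<open>a * b\<close> (\<open>lift_ends_iff\<close>), so positive edges can be mapped along
  \<open>g\<close> precisely when \<open>c\<close> satisfies the switching equation.
\<close>

section \<open>Signs\<close>

lemma ex_sign_iff: "(\<exists>s. P s) \<longleftrightarrow> P Pos \<or> P Neg"
  by (metis (full_types) sign.exhaust)

lemma Pos_mult [simp]: "Pos * a = a" "a * Pos = a"
  by (cases a; simp add: times_sign_def)+

lemma sign_mult_self [simp]: "a * a = (1 :: sign)"
  by (simp add: times_sign_def one_sign_def)

lemma sign_mult_self_left [simp]: "a * (a * b) = (b :: sign)"
  by (simp flip: mult.assoc)

lemma sign_mult_eq_1_iff: "a * b = 1 \<longleftrightarrow> a = (b :: sign)"
  by (simp add: times_sign_def one_sign_def)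

lemma sign_eq_mult_iff: "a = b * c \<longleftrightarrow> a * c = (b :: sign)"
  by (cases a; cases b; cases c) (simp_all add: times_sign_def one_sign_def)

section \<open>Potentials of balanced edge weights\<close>

definition gain :: "('e \<Rightarrow> sign) \<Rightarrow> ('e \<times> 'v) list \<Rightarrow> sign" where
  "gain w p = prod_list (map (w \<circ> fst) p)"

lemma gain_simps [simp]:
  "gain w [] = 1" "gain w (x # p) = w (fst x) * gain w p" "gain w (p @ q) = gain w p * gain w q"
  by (simp_all add: gain_def)

lemma walk_sign_eq_gain: "walk_sign G p = gain (esign G) p"
  by (simp add: walk_sign_def gain_def comp_def case_prod_unfold)

lemma walk_sign_map: "walk_sign H (map (map_prod g f) p) = gain (\<lambda>e. esign H (g e)) p"
  by (simp add: walk_sign_def gain_def comp_def case_prod_unfold)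

lemma gain_mult: "gain (\<lambda>e. w e * w' e) p = gain w p * gain w' p"
  by (induction p) (simp_all add: ac_simps)

lemma walk_ends_in_verts: "walk G u p v \<Longrightarrow> u \<in> verts G \<and> v \<in> verts G"
  by (induction G u p v rule: walk.induct) auto

lemma walk_append: "walk G u p v \<Longrightarrow> walk G v q x \<Longrightarrow> walk G u (p @ q) x"
  by (induction G u p v rule: walk.induct) auto

lemma walk_reverse:
  "walk G u p v \<Longrightarrow> \<exists>q. walk G v q u \<and> gain w q = gain w p"
proof (induction G u p v rule: walk.induct)
  case (1 G u w')
  then show ?case by (intro exI[of _ "[]"]) auto
next
  case (2 G u e v p x)
  then obtain q where q: "walk G x q v" "gain w q = gain w p" by auto
  have "walk G v [(e, u)] u"
    using 2 walk_ends_in_verts[OF q(1)] by (auto simp: add_mset_commute)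
  with q have "walk G x (q @ [(e, u)]) u"
    by (blast intro: walk_append)
  with q(2) show ?case
    by (intro exI[of _ "q @ [(e, u)]"]) (simp add: ac_simps)
qed

definition is_potential :: "('v, 'e, 'a) graph_scheme \<Rightarrow> ('e \<Rightarrow> sign) \<Rightarrow> ('v \<Rightarrow> sign) \<Rightarrow> bool" where
  "is_potential G w c \<longleftrightarrow> (\<forall>e\<in>edges G. \<forall>u v. ends G e = {#u, v#} \<longrightarrow> w e = c u * c v)"

text \<open>The contributions of the inner vertices cancel in pairs.\<close>

lemma gain_of_potential:
  assumes "is_potential G w c" and "walk G u p v"
  shows "gain w p = c u * c v"
  using assms(2,1)
  by (induction G u p v rule: walk.induct) (auto simp: is_potential_def ac_simps)

lemma balanced_imp_potential:
  assumes wf: "wf_graph G"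
    and balanced: "\<And>v p. walk G v p v \<Longrightarrow> gain w p = 1"
  shows "\<exists>c. is_potential G w c"
proof -
  define root where "root v = (SOME x. \<exists>p. walk G x p v)" for v
  define path where "path v = (SOME p. walk G (root v) p v)" for v
  have path: "walk G (root v) (path v) v" if "v \<in> verts G" for v
  proof -
    have "walk G v [] v" using that by simp
    then have "\<exists>p. walk G (root v) p v"
      unfolding root_def by (rule_tac someI_ex) blast
    then show ?thesis unfolding path_def by (rule someI_ex)
  qed
  have "w e = gain w (path u) * gain w (path v)"
    if e: "e \<in> edges G" and ends: "ends G e = {#u, v#}" for e u v
  proof -
    have uv: "u \<in> verts G" "v \<in> verts G"
      using wf e ends by (auto simp: wf_graph_def)
    have step: "walk G u [(e, v)] v" "walk G v [(e, u)] u"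
      using e ends uv by (simp_all add: add_mset_commute)
    \<comment> \<open>Adjacent vertices are reached from the same vertices, so the same root is selected.\<close>
    have "(\<exists>p. walk G x p u) \<longleftrightarrow> (\<exists>p. walk G x p v)" for x
      using step by (blast intro: walk_append)
    then have root: "root u = root v" by (simp add: root_def)
    obtain q where q: "walk G v q (root v)" "gain w q = gain w (path v)"
      using walk_reverse[OF path[OF uv(2)]] by blast
    have "walk G (root v) (path u @ [(e, v)] @ q) (root v)"
      using path[OF uv(1)] step(1) q(1) root by (metis walk_append)
    then have "gain w (path u @ [(e, v)] @ q) = 1" by (rule balanced)
    then have "w e * (gain w (path u) * gain w (path v)) = 1"
      using q(2) by (simp add: ac_simps)
    then show ?thesis by (simp add: sign_mult_eq_1_iff)
  qed
  then have "is_potential G w (\<lambda>v. gain w (path v))"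
    by (simp add: is_potential_def)
  then show ?thesis by blast
qed

text \<open>
  Every sign is its own inverse, so the product of the two signatures is also their quotient, and
  preserving the signs of closed walks means that this quotient is balanced.
\<close>

lemma signed_hom_iff_switching:
  assumes "wf_graph G"
  shows "signed_hom G H f g \<longleftrightarrow>
    graph_hom G H f g \<and> (\<exists>c. is_potential G (\<lambda>e. esign H (g e) * esign G e) c)"
proof -
  let ?w = "\<lambda>e. esign H (g e) * esign G e"
  have "walk_sign H (map (map_prod g f) p) = walk_sign G p \<longleftrightarrow> gain ?w p = 1" for p
    unfolding walk_sign_map walk_sign_eq_gain[of G] by (simp add: gain_mult sign_mult_eq_1_iff)
  moreover have "(\<forall>v p. walk G v p v \<longrightarrow> gain ?w p = 1) \<longleftrightarrow> (\<exists>c. is_potential G ?w c)"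
    using balanced_imp_potential[OF assms] by (auto dest: gain_of_potential)
  ultimately show ?thesis by (simp add: signed_hom_def)
qed

section \<open>Edges of the extended double cover\<close>

lemma EDC_simps [simp]:
  "verts (EDC G) = verts G \<times> UNIV"
  "Fiber x \<in> edges (EDC G) \<longleftrightarrow> x \<in> verts G"
  "Lift e s \<in> edges (EDC G) \<longleftrightarrow> e \<in> edges G"
  "ends (EDC G) (Fiber x) = {#(x, Pos), (x, Neg)#}"
  "ends (EDC G) (Lift e s) = lift_ends G e s"
  "esign (EDC G) (Fiber x) = Neg"
  "esign (EDC G) (Lift e s) = Pos"
  by (auto simp: EDC_def)

lemma lift_ends_eq:
  "end_pair G e = (u, v) \<Longrightarrow> lift_ends G e s = {#(u, s), (v, esign G e * s)#}"
  by (cases "esign G e") (simp_all add: lift_ends_def)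

lemma pair_mset_eq_iff: "{#a, b#} = {#c, d#} \<longleftrightarrow> a = c \<and> b = d \<or> a = d \<and> b = c"
  by (auto simp: add_eq_conv_ex)

text \<open>
  This describes the two lifts of an edge without referring to the chosen order of its endpoints:
  any pair of vertices over the endpoints with the right product of signs is joined by one of them.
\<close>

lemma lift_ends_iff:
  assumes "wf_graph G" and "e \<in> edges G"
  shows "(\<exists>t. lift_ends G e t = {#(u, a), (v, b)#}) \<longleftrightarrow> ends G e = {#u, v#} \<and> a * b = esign G e"
proof -
  obtain x y where xy: "end_pair G e = (x, y)" by fastforce
  note [simp] = lift_ends_eq[OF xy] end_pair[OF assms xy]
  show ?thesis
    by (cases "esign G e"; cases a; cases b;
        simp add: ex_sign_iff pair_mset_eq_iff times_sign_def one_sign_def; blast)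
qed

text \<open>A fiber can be written down starting from either of its two ends.\<close>

lemma fiber_mset: "{#(x, a), (x, a * Neg)#} = {#(x, Pos), (x, Neg)#}"
  by (cases a) (simp_all add: one_sign_def add_mset_commute)

section \<open>Switching and homomorphisms of double covers\<close>

text \<open>
  The vertex map twisted by \<open>c\<close> sends the ends of a lift of \<open>e = uv\<close> to vertices whose signs multiply
  to \<open>c u * c v * \<sigma> e\<close>. By the switching equation this is the sign of \<open>g e\<close>, so some lift of
  \<open>g e\<close> joins them; which one depends on the lift of \<open>e\<close> and on the endpoint orders.
\<close>

lemma switching_imp_color_hom:
  assumes wf: "wf_graph G" "wf_graph H"
    and hom: "graph_hom G H f g"
    and pot: "is_potential G (\<lambda>e. esign H (g e) * esign G e) c"
  shows "\<exists>k. color_hom (EDC G) (EDC H) (\<lambda>(v, s). (f v, c v * s)) k"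
proof -
  let ?F = "\<lambda>(v, s). (f v, c v * s)"
  have ex: "\<exists>t. lift_ends H (g e) t = image_mset ?F (lift_ends G e s)"
    if e: "e \<in> edges G" for e s
  proof -
    obtain u v where uv: "end_pair G e = (u, v)" by fastforce
    have ends: "ends G e = {#u, v#}" by (rule end_pair[OF wf(1) e uv])
    have "esign H (g e) * esign G e = c u * c v"
      using pot e ends by (simp add: is_potential_def)
    then have "esign H (g e) = c u * c v * esign G e"
      by (simp add: sign_eq_mult_iff)
    then have "(c u * s) * (c v * (esign G e * s)) = esign H (g e)"
      by (simp add: ac_simps)
    moreover have "ends H (g e) = {#f u, f v#}" "g e \<in> edges H"
      using hom e ends by (auto simp: graph_hom_def)
    ultimately show ?thesis
      using lift_ends_iff[OF wf(2)] by (simp add: lift_ends_eq[OF uv])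
  qed
  then obtain t where t:
    "\<And>e s. e \<in> edges G \<Longrightarrow> lift_ends H (g e) (t e s) = image_mset ?F (lift_ends G e s)"
    by metis
  define k where "k a = (case a of Fiber x \<Rightarrow> Fiber (f x) | Lift e s \<Rightarrow> Lift (g e) (t e s))" for a
  have "a \<in> edges (EDC G) \<Longrightarrow> k a \<in> edges (EDC H) \<and>
      ends (EDC H) (k a) = image_mset ?F (ends (EDC G) a) \<and> esign (EDC H) (k a) = esign (EDC G) a"
    for a
    using hom t by (cases a) (auto simp: k_def graph_hom_def fiber_mset)
  then have "color_hom (EDC G) (EDC H) ?F k"
    using hom by (auto simp: color_hom_def graph_hom_def)
  then show ?thesis by blast
qed

text \<open>
  Projecting the homomorphism to \<open>G\<close> and \<open>H\<close> loses the signs of the vertices; since fibers are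
  preserved, what is lost is a single sign \<open>c v\<close> for each vertex. The image of an edge is read off
  from its lift with index \<open>Pos\<close>; this choice is arbitrary, as the image of either lift satisfies
  the switching equation.
\<close>

lemma color_hom_imp_switching:
  assumes wf: "wf_graph G" "wf_graph H"
    and hom: "color_hom (EDC G) (EDC H) F k"
  shows "\<exists>f g c. graph_hom G H f g \<and> is_potential G (\<lambda>e. esign H (g e) * esign G e) c"
proof -
  define f where "f v = fst (F (v, Pos))" for v
  define c where "c v = snd (F (v, Pos))" for v
  define g where "g e = (case k (Lift e Pos) of Lift d t \<Rightarrow> d)" for e
  have k_in: "k a \<in> edges (EDC H)"
    and k_ends: "ends (EDC H) (k a) = image_mset F (ends (EDC G) a)"
    and k_sign: "esign (EDC H) (k a) = esign (EDC G) a" if "a \<in> edges (EDC G)" for a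
    using hom that by (auto simp: color_hom_def graph_hom_def)
  \<comment> \<open>Negative edges of the double cover are fibers, so \<open>F\<close> maps fibers to fibers.\<close>
  have F: "F (v, s) = (f v, c v * s)" if "v \<in> verts G" for v s
  proof -
    have v: "Fiber v \<in> edges (EDC G)" using that by simp
    then obtain y where "k (Fiber v) = Fiber y"
      using k_sign[OF v] by (cases "k (Fiber v)") auto
    with k_ends[OF v] have "{#(y, Pos), (y, Neg)#} = {#F (v, Pos), F (v, Neg)#}"
      by simp
    then have "F (v, Pos) = (y, Pos) \<and> F (v, Neg) = (y, Neg) \<or>
        F (v, Pos) = (y, Neg) \<and> F (v, Neg) = (y, Pos)"
      unfolding pair_mset_eq_iff by metis
    then have "F (v, Neg) = (f v, Neg * c v)"
      by (auto simp: f_def c_def one_sign_def)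
    then show ?thesis
      by (cases s) (simp_all add: f_def c_def ac_simps flip: one_sign_def)
  qed
  have g: "g e \<in> edges H \<and> ends H (g e) = {#f u, f v#} \<and> esign H (g e) * esign G e = c u * c v"
    if e: "e \<in> edges G" and uv: "end_pair G e = (u, v)" for e u v
  proof -
    have e': "Lift e Pos \<in> edges (EDC G)" using e by simp
    then obtain d t where d: "k (Lift e Pos) = Lift d t"
      using k_sign[OF e'] by (cases "k (Lift e Pos)") auto
    with k_in[OF e'] have dH: "d \<in> edges H" by simp
    have "u \<in> verts G" "v \<in> verts G"
      using end_pair[OF wf(1) e uv] wf(1) e by (auto simp: wf_graph_def)
    with k_ends[OF e'] d have "lift_ends H d t = {#(f u, c u), (f v, c v * esign G e)#}"
      by (simp add: lift_ends_eq[OF uv] F flip: one_sign_def)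
    then have ends: "ends H d = {#f u, f v#}" and sign: "c u * (c v * esign G e) = esign H d"
      using lift_ends_iff[OF wf(2) dH] by blast+
    have "esign H d * esign G e = c u * c v"
      unfolding sign[symmetric] by (simp add: mult.assoc)
    moreover have "g e = d" by (simp add: g_def d)
    ultimately show ?thesis using dH ends by simp
  qed
  have "f \<in> verts G \<rightarrow> verts H"
    using hom by (auto simp: color_hom_def graph_hom_def f_def Pi_iff mem_Times_iff)
  moreover have "g e \<in> edges H \<and> ends H (g e) = image_mset f (ends G e)" if e: "e \<in> edges G" for e
  proof -
    obtain u v where uv: "end_pair G e = (u, v)" by fastforce
    show ?thesis using g[OF e uv] end_pair[OF wf(1) e uv] by simp
  qed
  ultimately have "graph_hom G H f g" by (auto simp: graph_hom_def)
  moreover have "esign H (g e) * esign G e = c x * c y"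
    if e: "e \<in> edges G" and xy: "ends G e = {#x, y#}" for e x y
  proof -
    obtain u v where uv: "end_pair G e = (u, v)" by fastforce
    have "{#x, y#} = {#u, v#}" using end_pair[OF wf(1) e uv] xy by simp
    then have "x = u \<and> y = v \<or> x = v \<and> y = u" by (auto simp: pair_mset_eq_iff)
    then show ?thesis using g[OF e uv] by (auto simp: ac_simps)
  qed
  then have "is_potential G (\<lambda>e. esign H (g e) * esign G e) c"
    by (simp add: is_potential_def)
  ultimately show ?thesis by blast
qed

theorem theorem28:
  fixes G :: "('v, 'e) sgraph" and H :: "('w, 'd) sgraph"
  assumes "wf_graph G" and "wf_graph H"
  shows "(\<exists>f g. signed_hom G H f g) \<longleftrightarrow> (\<exists>f g. color_hom (EDC G) (EDC H) f g)"
  using switching_imp_color_hom[OF assms] color_hom_imp_switching[OF assms]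
  unfolding signed_hom_iff_switching[OF assms(1)] by blast

end
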